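(* For every integer $r \geq 3$, the limit $\operatorname{csat}(K_r) = \lim_{n\to\infty} \operatorname{csat}(n,K_r)/n$ exists and $$\operatorname{csat}(K_r) = r - \frac{3}{2},$$ where $K_r$ is the complete graph on $r$ vertices.
   Context: All graphs are simple, finite and undirected, and have at least one edge. A "copy of $F$" in $G$ is a (not necessarily induced) subgraph of $G$ isomorphic to $F$. A graph $G$ is $F$-covered if every edge of $G$ lies in a copy of $F$ in $G$. A graph $G$ is $F$-semi-saturated if for every edge $e$ of the complement of $G$, the graph $G+e$ contains more copies of $F$ than $G$ does (equivalently, $G+e$ contains a copy of $F$ using $e$). A graph is $F$-cov-sat if it is both $F$-covered and $F$-semi-saturated. For $n \geq |F|$ (where $|F|$ is the number of vertices of $F$), $\operatorname{csat}(n,F)$ is the minimum number of edges of an $F$-cov-sat graph on exactly $n$ vertices. *)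

theory Defs
  imports Complex_Main
begin

type_synonym 'a ugraph = "'a set \<times> 'a set set"

abbreviation vertices :: "'a ugraph \<Rightarrow> 'a set" where
  "vertices \<equiv> fst"

abbreviation edges :: "'a ugraph \<Rightarrow> 'a set set" where
  "edges \<equiv> snd"

definition all_pairs :: "'a set \<Rightarrow> 'a set set" where
  "all_pairs V = {e. e \<subseteq> V \<and> card e = 2}"

(* Simple, finite, undirected, and with at least one edge. Without the last conjunct the
   edgeless graphs would be (vacuously) F-covered. *)
definition is_graph :: "'a ugraph \<Rightarrow> bool" where
  "is_graph G \<longleftrightarrow> finite (vertices G) \<and> edges G \<subseteq> all_pairs (vertices G) \<and> edges G \<noteq> {}"

definition isomorphic :: "'a ugraph \<Rightarrow> 'b ugraph \<Rightarrow> bool" where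
  "isomorphic G H \<longleftrightarrow>
     (\<exists>f. bij_betw f (vertices G) (vertices H) \<and>
          (\<forall>u\<in>vertices G. \<forall>v\<in>vertices G. {u, v} \<in> edges G \<longleftrightarrow> {f u, f v} \<in> edges H))"

definition subgraph :: "'a ugraph \<Rightarrow> 'a ugraph \<Rightarrow> bool" where
  "subgraph H G \<longleftrightarrow> is_graph H \<and> vertices H \<subseteq> vertices G \<and> edges H \<subseteq> edges G"

definition copies :: "'b ugraph \<Rightarrow> 'a ugraph \<Rightarrow> 'a ugraph set" where
  "copies F G = {H. subgraph H G \<and> isomorphic F H}"

definition covered :: "'b ugraph \<Rightarrow> 'a ugraph \<Rightarrow> bool" where
  "covered F G \<longleftrightarrow> (\<forall>e\<in>edges G. \<exists>H\<in>copies F G. e \<in> edges H)"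

definition add_edge :: "'a ugraph \<Rightarrow> 'a set \<Rightarrow> 'a ugraph" where
  "add_edge G e = (vertices G, insert e (edges G))"

definition semi_saturated :: "'b ugraph \<Rightarrow> 'a ugraph \<Rightarrow> bool" where
  "semi_saturated F G \<longleftrightarrow>
     (\<forall>e\<in>all_pairs (vertices G) - edges G. card (copies F (add_edge G e)) > card (copies F G))"

definition cov_sat :: "'b ugraph \<Rightarrow> 'a ugraph \<Rightarrow> bool" where
  "cov_sat F G \<longleftrightarrow> covered F G \<and> semi_saturated F G"

(* Every finite graph is isomorphic to one whose vertices are natural numbers, so the vertex
   type nat is no restriction. For n >= |F| the complete graph on n vertices is F-cov-sat, so
   the minimum is attained; for smaller n the value is irrelevant. *)
definition csat :: "nat \<Rightarrow> 'b ugraph \<Rightarrow> nat" where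
  "csat n F =
     (LEAST m. \<exists>G :: nat ugraph. is_graph G \<and> card (vertices G) = n \<and> cov_sat F G \<and>
                 card (edges G) = m)"

definition complete_graph :: "nat \<Rightarrow> nat ugraph" where
  "complete_graph r = ({..<r}, all_pairs {..<r})"

end

theory Submission
  imports Defs
begin

text \<open>
  \<^bold>\<open>Upper bound.\<close> Join a clique on \<open>r - 2\<close> vertices to a graph \<open>M\<close> without isolated vertices on the
  remaining vertices. Every edge then lies in the \<open>r\<close>-clique formed by the core and some edge of
  \<open>M\<close>, and any two non-adjacent vertices become, once joined, the missing edge of an \<open>r\<close>-clique
  through the core. Taking for \<open>M\<close> a matching, with one more edge when the parity requires it, costs
  \<open>(r - 2) n + n / 2\<close> edges up to an additive constant (\<open>cov_sat_join\<close>, \<open>small_edge_cover\<close>).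

  \<^bold>\<open>Lower bound.\<close> Fix \<open>t\<close> and split the vertices of a cov-sat graph with \<open>e\<close> edges into the set \<open>A\<close>
  of vertices of degree greater than \<open>t\<close> and the set \<open>B\<close> of the others. Semi-saturation says that
  non-adjacent vertices have at least \<open>r - 2\<close> common neighbours. If some \<open>v\<close> in \<open>B\<close> had fewer than
  \<open>r - 2\<close> neighbours in \<open>A\<close>, every vertex not adjacent to \<open>v\<close> could be reached from \<open>v\<close> by a path of
  length two through \<open>B\<close>, and there would be at most \<open>1 + t + t\<^sup>2\<close> vertices in total. So
  for large \<open>n\<close> each vertex of \<open>B\<close> sends \<open>r - 2\<close> edges to \<open>A\<close>; as it lies in an \<open>r\<close>-clique, it has
  yet another neighbour, and an edge towards that one is shared with at most one other vertex of
  \<open>B\<close>. This gives \<open>(r - 3 / 2) |B| \<le> e\<close>, while \<open>(t + 1) |A| \<le> 2 e\<close>; letting \<open>t\<close> grow makes \<open>A\<close>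
  negligible (\<open>cov_sat_edge_bound\<close>).
\<close>

section \<open>Copies of a complete graph\<close>

lemma all_pairs_mono: "A \<subseteq> B \<Longrightarrow> all_pairs A \<subseteq> all_pairs B"
  by (auto simp: all_pairs_def)

lemma pair_in_all_pairs_iff: "{u, v} \<in> all_pairs V \<longleftrightarrow> u \<in> V \<and> v \<in> V \<and> u \<noteq> v"
  by (auto simp: all_pairs_def card_2_iff doubleton_eq_iff)

lemma all_pairsE:
  assumes "e \<in> all_pairs V"
  obtains u v where "e = {u, v}" "u \<in> V" "v \<in> V" "u \<noteq> v"
  using assms by (auto simp: all_pairs_def card_2_iff)

lemma finite_all_pairs: "finite V \<Longrightarrow> finite (all_pairs V)"
  by (simp add: all_pairs_def)

lemma isomorphic_complete_graph_iff:
  fixes H :: "'a ugraph"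
  assumes "is_graph H"
  shows "isomorphic (complete_graph r) H \<longleftrightarrow>
    card (vertices H) = r \<and> edges H = all_pairs (vertices H)"
proof
  assume "isomorphic (complete_graph r) H"
  then obtain f where f: "bij_betw f {..<r} (vertices H)"
    and adj: "\<And>u v. u < r \<Longrightarrow> v < r \<Longrightarrow> {u, v} \<in> all_pairs {..<r} \<longleftrightarrow> {f u, f v} \<in> edges H"
    by (auto simp: isomorphic_def complete_graph_def)
  have "all_pairs (vertices H) \<subseteq> edges H"
  proof
    fix e assume "e \<in> all_pairs (vertices H)"
    then obtain a b where e: "e = {a, b}" and ab: "a \<in> vertices H" "b \<in> vertices H" "a \<noteq> b"
      by (rule all_pairsE)
    obtain u v where "u < r" "v < r" "a = f u" "b = f v"
      using ab(1,2) f unfolding bij_betw_def by blast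
    with adj[of u v] ab e show "e \<in> edges H"
      by (auto simp: pair_in_all_pairs_iff)
  qed
  moreover have "edges H \<subseteq> all_pairs (vertices H)"
    using assms by (simp add: is_graph_def)
  ultimately show "card (vertices H) = r \<and> edges H = all_pairs (vertices H)"
    using bij_betw_same_card[OF f] by auto
next
  assume H: "card (vertices H) = r \<and> edges H = all_pairs (vertices H)"
  have "finite (vertices H)"
    using assms by (simp add: is_graph_def)
  then obtain f where f: "bij_betw f {..<r} (vertices H)"
    using H finite_same_card_bij[of "{..<r}" "vertices H"] by auto
  have "\<forall>u<r. \<forall>v<r. {u, v} \<in> all_pairs {..<r} \<longleftrightarrow> {f u, f v} \<in> edges H"
    using f H by (auto simp: pair_in_all_pairs_iff bij_betw_def inj_on_def)
  with f show "isomorphic (complete_graph r) H"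
    unfolding isomorphic_def complete_graph_def by (intro exI[of _ f]) auto
qed

lemma clique_in_copies:
  assumes "finite Q" "card Q = r" "r \<ge> 2" "Q \<subseteq> vertices G" "all_pairs Q \<subseteq> edges G"
  shows "(Q, all_pairs Q) \<in> copies (complete_graph r) G"
proof -
  obtain P where "P \<subseteq> Q" "card P = 2"
    using assms by (metis obtain_subset_with_card_n)
  then have "is_graph (Q, all_pairs Q)"
    using assms by (auto simp: is_graph_def all_pairs_def)
  then show ?thesis
    using assms isomorphic_complete_graph_iff[of "(Q, all_pairs Q)" r]
    by (auto simp: copies_def subgraph_def)
qed

lemma copiesD:
  assumes "H \<in> copies (complete_graph r) G"
  shows "finite (vertices H)" "card (vertices H) = r" "vertices H \<subseteq> vertices G"
    "edges H = all_pairs (vertices H)" "edges H \<subseteq> edges G"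
  using assms isomorphic_complete_graph_iff[of H r]
  by (auto simp: copies_def subgraph_def is_graph_def)

lemma copies_add_edge: "copies F G \<subseteq> copies F (add_edge G e)"
  by (auto simp: copies_def subgraph_def add_edge_def)

lemma finite_copies:
  assumes "finite (vertices G)" "finite (edges G)"
  shows "finite (copies F G)"
proof (rule finite_subset)
  show "copies F G \<subseteq> Pow (vertices G) \<times> Pow (edges G)"
    by (auto simp: copies_def subgraph_def)
qed (use assms in auto)

section \<open>A cov-sat graph with few edges\<close>

text \<open>The graph below is the join of a clique on \<open>K\<close> with the graph \<open>M\<close> on the other vertices. The
  cliques that it needs are \<open>K \<union> m\<close> with \<open>m\<close> an edge or a non-edge outside \<open>K\<close>; an edge meeting \<open>K\<close>
  is contained in such a clique because \<open>M\<close> has no isolated vertex.\<close>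

lemma cov_sat_join:
  assumes V: "finite V" "K \<subseteq> V" "card K + 2 = r"
    and M: "M \<subseteq> all_pairs (V - K)" "\<Union>M = V - K" "M \<noteq> {}"
  defines "E \<equiv> M \<union> {e \<in> all_pairs V. e \<inter> K \<noteq> {}}"
  shows "is_graph (V, E)" "cov_sat (complete_graph r) (V, E)"
proof -
  have "finite K"
    using V finite_subset by blast
  have E: "E \<subseteq> all_pairs V"
    using M(1) all_pairs_mono[of "V - K" V] by (auto simp: E_def)
  then show "is_graph (V, E)"
    using V M(3) by (auto simp: is_graph_def E_def)
  have card_extend: "finite (K \<union> m)" "card (K \<union> m) = r" "K \<union> m \<subseteq> V"
    if "m \<in> all_pairs (V - K)" for m
  proof -
    have "finite m" "card m = 2" "K \<inter> m = {}" "m \<subseteq> V"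
      using that V(1) finite_subset by (auto simp: all_pairs_def)
    then show "finite (K \<union> m)" "card (K \<union> m) = r" "K \<union> m \<subseteq> V"
      using V \<open>finite K\<close> by (auto simp: card_Un_disjoint)
  qed
  have pairs_extend: "all_pairs (K \<union> m) \<subseteq> insert m E" if m: "m \<in> all_pairs (V - K)" for m
  proof
    fix e assume e: "e \<in> all_pairs (K \<union> m)"
    show "e \<in> insert m E"
    proof (cases "e \<inter> K = {}")
      case True
      with e have "e \<subseteq> m" "card e = 2"
        by (auto simp: all_pairs_def)
      moreover have "finite m" "card m = 2"
        using m V(1) finite_subset by (auto simp: all_pairs_def)
      ultimately show ?thesis
        using card_subset_eq[of m e] by simp
    next
      case False
      then show ?thesis
        using e all_pairs_mono[OF card_extend(3)[OF m]] by (auto simp: E_def)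
    qed
  qed
  have "covered (complete_graph r) (V, E)"
    unfolding covered_def
  proof
    fix e assume "e \<in> edges (V, E)"
    then have e: "e \<in> E" by simp
    have "\<exists>m\<in>M. e \<subseteq> K \<union> m"
    proof (cases "e \<in> M")
      case False
      then have "e \<in> all_pairs V" "e \<inter> K \<noteq> {}"
        using e by (auto simp: E_def)
      then obtain a b where ab: "e = {a, b}" "a \<in> K" "b \<in> V"
        by (auto elim!: all_pairsE)
      show ?thesis
      proof (cases "b \<in> K")
        case True
        then show ?thesis using ab M(3) by auto
      next
        case False
        then obtain m where "m \<in> M" "b \<in> m"
          using ab M(2) by blast
        then show ?thesis using ab by auto
      qed
    qed auto
    then obtain m where m: "m \<in> M" "e \<subseteq> K \<union> m" by blast
    then have "all_pairs (K \<union> m) \<subseteq> E"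
      using pairs_extend[of m] M(1) by (auto simp: E_def)
    moreover have "m \<in> all_pairs (V - K)"
      using m M(1) by blast
    ultimately have "(K \<union> m, all_pairs (K \<union> m)) \<in> copies (complete_graph r) (V, E)"
      using card_extend[of m] V(3) by (intro clique_in_copies) auto
    moreover have "e \<in> all_pairs (K \<union> m)"
      using m(2) e E by (auto simp: all_pairs_def)
    ultimately show "\<exists>H\<in>copies (complete_graph r) (V, E). e \<in> edges H"
      by force
  qed
  moreover have "semi_saturated (complete_graph r) (V, E)"
    unfolding semi_saturated_def
  proof
    fix e assume "e \<in> all_pairs (vertices (V, E)) - edges (V, E)"
    then have e: "e \<in> all_pairs V" "e \<notin> E" by auto
    then have e': "e \<in> all_pairs (V - K)"
      by (auto simp: E_def all_pairs_def)
    let ?H = "(K \<union> e, all_pairs (K \<union> e))"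
    have "?H \<in> copies (complete_graph r) (add_edge (V, E) e)"
      using card_extend[OF e'] pairs_extend[OF e'] V(3)
      by (intro clique_in_copies) (auto simp: add_edge_def)
    moreover have "?H \<notin> copies (complete_graph r) (V, E)"
      using e by (auto simp: copies_def subgraph_def all_pairs_def)
    ultimately have "copies (complete_graph r) (V, E) \<subset> copies (complete_graph r) (add_edge (V, E) e)"
      using copies_add_edge by blast
    moreover have "finite (copies (complete_graph r) (add_edge (V, E) e))"
      using V(1) finite_subset[OF E finite_all_pairs]
      by (intro finite_copies) (auto simp: add_edge_def)
    ultimately show "card (copies (complete_graph r) (V, E)) <
        card (copies (complete_graph r) (add_edge (V, E) e))"
      by (simp add: psubset_card_mono)
  qed
  ultimately show "cov_sat (complete_graph r) (V, E)"
    by (simp add: cov_sat_def)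
qed

lemma card_pairs_meeting_le:
  assumes "finite V" "K \<subseteq> V"
  shows "card {e \<in> all_pairs V. e \<inter> K \<noteq> {}} \<le> card K * card V"
proof -
  have "{e \<in> all_pairs V. e \<inter> K \<noteq> {}} \<subseteq> (\<lambda>(a, b). {a, b}) ` (K \<times> V)"
  proof clarify
    fix e assume "e \<in> all_pairs V" "e \<inter> K \<noteq> {}"
    then obtain a b where "e = {a, b}" "a \<in> K" "b \<in> V"
      by (auto elim!: all_pairsE)
    then show "e \<in> (\<lambda>(a, b). {a, b}) ` (K \<times> V)"
      by force
  qed
  moreover have "finite (K \<times> V)"
    using assms finite_subset by blast
  ultimately have "card {e \<in> all_pairs V. e \<inter> K \<noteq> {}} \<le> card (K \<times> V)"
    by (meson card_image_le card_mono finite_imageI le_trans)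
  then show ?thesis
    by (simp add: card_cartesian_product)
qed

text \<open>Pairs of vertices are split off one at a time; a last odd vertex is joined to a vertex that
  is already covered.\<close>

lemma small_edge_cover:
  assumes "finite W" "card W \<ge> 2"
  shows "\<exists>M \<subseteq> all_pairs W. \<Union>M = W \<and> card M \<le> (card W + 1) div 2"
  using assms
proof (induction W rule: finite_psubset_induct)
  case (psubset W)
  obtain P where "P \<subseteq> W" "card P = 2"
    using psubset.prems by (metis obtain_subset_with_card_n)
  then obtain a b where P: "P = {a, b}" "a \<noteq> b" "a \<in> W" "b \<in> W"
    by (auto simp: card_2_iff)
  define W' where "W' = W - P"
  have W: "W = insert a (insert b W')" "a \<notin> W'" "b \<notin> W'" "finite W'"
    using P psubset.hyps by (auto simp: W'_def)
  then have card_W: "card W = card W' + 2"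
    using P(2) by simp
  consider "card W' = 0" | "card W' = 1" | "card W' \<ge> 2"
    by linarith
  then show ?case
  proof cases
    case 1
    then have "W' = {}" using W by simp
    then show ?thesis
      using W P by (intro exI[of _ "{{a, b}}"]) (auto simp: pair_in_all_pairs_iff)
  next
    case 2
    then obtain c where c: "W' = {c}" by (auto simp: card_1_singleton_iff)
    have "card {{a, b}, {b, c}} \<le> 2"
      by (simp add: card_insert_if)
    then show ?thesis
      using W P c card_W
      by (intro exI[of _ "{{a, b}, {b, c}}"]) (auto simp: pair_in_all_pairs_iff)
  next
    case 3
    have "W' \<subset> W" using W by auto
    then obtain M where M: "M \<subseteq> all_pairs W'" "\<Union>M = W'" "card M \<le> (card W' + 1) div 2"
      using psubset.IH[OF \<open>W' \<subset> W\<close> 3] by auto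
    have "finite M"
      using finite_subset[OF M(1) finite_all_pairs[OF W(4)]] .
    then have "card (insert {a, b} M) \<le> card M + 1"
      by (simp add: card_insert_if)
    moreover have "all_pairs W' \<subseteq> all_pairs W"
      using \<open>W' \<subset> W\<close> by (intro all_pairs_mono) auto
    ultimately show ?thesis
      using M W P card_W
      by (intro exI[of _ "insert {a, b} M"]) (auto simp: pair_in_all_pairs_iff)
  qed
qed

lemma small_cov_sat_graph:
  fixes n r :: nat
  assumes "r \<ge> 2" "n \<ge> r"
  shows "\<exists>G :: nat ugraph. is_graph G \<and> card (vertices G) = n \<and> cov_sat (complete_graph r) G \<and>
    card (edges G) \<le> (r - 2) * n + (n + 1) div 2"
proof -
  let ?V = "{..<n}" and ?K = "{..<r - 2}"
  have K: "?K \<subseteq> ?V" "card ?K + 2 = r"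
    using assms by auto
  have W: "card (?V - ?K) = n - (r - 2)"
    using K by (simp add: card_Diff_subset)
  then obtain M where M: "M \<subseteq> all_pairs (?V - ?K)" "\<Union>M = ?V - ?K"
    and M_card: "card M \<le> (card (?V - ?K) + 1) div 2"
    using small_edge_cover[of "?V - ?K"] assms by force
  have "n - 1 \<in> ?V - ?K"
    using assms by auto
  with M have "M \<noteq> {}" by auto
  define E where "E = M \<union> {e \<in> all_pairs ?V. e \<inter> ?K \<noteq> {}}"
  have "card E \<le> card M + card {e \<in> all_pairs ?V. e \<inter> ?K \<noteq> {}}"
    unfolding E_def by (rule card_Un_le)
  also have "card {e \<in> all_pairs ?V. e \<inter> ?K \<noteq> {}} \<le> (r - 2) * n"
    using card_pairs_meeting_le[of ?V ?K] K by simp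
  also have "card M \<le> (n + 1) div 2"
    using M_card W by linarith
  finally have "card E \<le> (r - 2) * n + (n + 1) div 2"
    by simp
  moreover have "is_graph (?V, E)" "cov_sat (complete_graph r) (?V, E)"
    using cov_sat_join[OF _ K M \<open>M \<noteq> {}\<close>] by (simp_all add: E_def)
  ultimately show ?thesis
    by (intro exI[of _ "(?V, E)"]) simp
qed

section \<open>Neighbourhoods in cov-sat graphs\<close>

definition neighbours :: "'a ugraph \<Rightarrow> 'a \<Rightarrow> 'a set" where
  "neighbours G v = {w. {v, w} \<in> edges G}"

lemma neighbours_subset:
  assumes "is_graph G"
  shows "neighbours G v \<subseteq> vertices G - {v}"
  using assms by (force simp: neighbours_def is_graph_def all_pairs_def)

lemma finite_neighbours: "is_graph G \<Longrightarrow> finite (neighbours G v)"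
  using neighbours_subset finite_subset by (metis finite_Diff is_graph_def)

lemma neighbours_sym: "w \<in> neighbours G v \<longleftrightarrow> v \<in> neighbours G w"
  by (simp add: neighbours_def insert_commute)

text \<open>The common neighbours are the other \<open>r - 2\<close> vertices of a copy of \<open>K\<^sub>r\<close> created by the edge
  between \<open>u\<close> and \<open>v\<close>.\<close>

lemma common_neighbours_of_nonadjacent:
  assumes G: "is_graph G" "semi_saturated (complete_graph r) G"
    and uv: "u \<in> vertices G" "v \<in> vertices G" "u \<noteq> v" "u \<notin> neighbours G v"
  shows "r - 2 \<le> card (neighbours G u \<inter> neighbours G v)"
proof -
  let ?F = "complete_graph r"
  have "{u, v} \<in> all_pairs (vertices G) - edges G"
    using uv by (auto simp: pair_in_all_pairs_iff neighbours_def insert_commute)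
  then have "card (copies ?F (add_edge G {u, v})) > card (copies ?F G)"
    using G(2) by (auto simp: semi_saturated_def)
  then obtain H where H: "H \<in> copies ?F (add_edge G {u, v})" "H \<notin> copies ?F G"
    using copies_add_edge[of ?F G "{u, v}"] by (metis less_irrefl subset_antisym subsetI)
  note H' = copiesD[OF H(1)]
  \<comment> \<open>A copy that avoids the new edge would already be a copy in the old graph.\<close>
  have "{u, v} \<in> edges H"
  proof (rule ccontr)
    assume "{u, v} \<notin> edges H"
    with H show False
      by (auto simp: copies_def subgraph_def add_edge_def)
  qed
  then have uvH: "u \<in> vertices H" "v \<in> vertices H"
    using H'(4) by (auto simp: pair_in_all_pairs_iff)
  have "vertices H - {u, v} \<subseteq> neighbours G u \<inter> neighbours G v"
  proof
    fix w assume w: "w \<in> vertices H - {u, v}"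
    then have "{u, w} \<in> edges H" "{v, w} \<in> edges H"
      using uvH H'(4) by (auto simp: pair_in_all_pairs_iff)
    then show "w \<in> neighbours G u \<inter> neighbours G v"
      using H'(5) w by (auto simp: neighbours_def add_edge_def doubleton_eq_iff)
  qed
  moreover have "card (vertices H - {u, v}) = r - 2"
    using uvH uv(3) H'(1,2) by (simp add: card_Diff_subset)
  ultimately show ?thesis
    using finite_neighbours[OF G(1)] by (metis card_mono finite_Int)
qed

text \<open>An isolated vertex would have no common neighbour with any other vertex, against
  semi-saturation; so every vertex lies on an edge, and therefore in an \<open>r\<close>-clique.\<close>

lemma cov_sat_min_degree:
  assumes G: "is_graph G" "cov_sat (complete_graph r) G" and "r \<ge> 3" and v: "v \<in> vertices G"
  shows "r - 1 \<le> card (neighbours G v)"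
proof -
  have "neighbours G v \<noteq> {}"
  proof
    assume empty: "neighbours G v = {}"
    obtain x y where "{x, y} \<in> edges G" "x \<in> vertices G" "y \<in> vertices G" "x \<noteq> y"
      using G(1) by (fastforce simp: is_graph_def elim: all_pairsE)
    then obtain u where "u \<in> vertices G" "u \<noteq> v"
      by metis
    with empty v have "r - 2 \<le> card (neighbours G u \<inter> neighbours G v)"
      using G by (intro common_neighbours_of_nonadjacent) (auto simp: cov_sat_def)
    with empty \<open>r \<ge> 3\<close> show False by simp
  qed
  then obtain w where "{v, w} \<in> edges G"
    by (auto simp: neighbours_def)
  then obtain H where H: "H \<in> copies (complete_graph r) G" "{v, w} \<in> edges H"
    using G(2) by (auto simp: cov_sat_def covered_def)
  note H' = copiesD[OF H(1)]
  have vH: "v \<in> vertices H"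
    using H(2) H'(4) by (simp add: pair_in_all_pairs_iff)
  have "vertices H - {v} \<subseteq> neighbours G v"
  proof
    fix x assume "x \<in> vertices H - {v}"
    then have "{v, x} \<in> edges H"
      using vH H'(4) by (auto simp: pair_in_all_pairs_iff)
    then show "x \<in> neighbours G v"
      using H'(5) by (auto simp: neighbours_def)
  qed
  moreover have "card (vertices H - {v}) = r - 1"
    using vH H'(2) by simp
  ultimately show ?thesis
    using finite_neighbours[OF G(1)] by (metis card_mono)
qed

text \<open>Otherwise all vertices other than \<open>v\<close> and its neighbours are adjacent to one of the
  at most \<open>t\<close> low-degree neighbours of \<open>v\<close>, each of which has at most \<open>t\<close> neighbours.\<close>

lemma low_degree_many_high_neighbours:
  assumes G: "is_graph G" "semi_saturated (complete_graph r) G"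
    and large: "card (vertices G) > 1 + t + t * t"
    and v: "v \<in> vertices G" "card (neighbours G v) \<le> t"
  shows "r - 2 \<le> card (neighbours G v \<inter> {w. t < card (neighbours G w)})"
proof (rule ccontr)
  assume few: "\<not> ?thesis"
  let ?L = "neighbours G v \<inter> {w. card (neighbours G w) \<le> t}"
  have fin: "finite (neighbours G w)" for w
    by (rule finite_neighbours[OF G(1)])
  have "vertices G \<subseteq> {v} \<union> neighbours G v \<union> (\<Union>w\<in>?L. neighbours G w)"
  proof
    fix u assume u: "u \<in> vertices G"
    show "u \<in> {v} \<union> neighbours G v \<union> (\<Union>w\<in>?L. neighbours G w)"
    proof (cases "u = v \<or> u \<in> neighbours G v")
      case False
      then have "r - 2 \<le> card (neighbours G u \<inter> neighbours G v)"
        using G u v by (intro common_neighbours_of_nonadjacent) auto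
      with few have "\<not> neighbours G u \<inter> neighbours G v
          \<subseteq> neighbours G v \<inter> {w. t < card (neighbours G w)}"
        using fin by (meson card_mono finite_Int order_trans)
      then obtain w where "w \<in> neighbours G u" "w \<in> ?L"
        by force
      then show ?thesis
        using neighbours_sym[of w G u] by blast
    qed auto
  qed
  then have "card (vertices G) \<le> card ({v} \<union> neighbours G v \<union> (\<Union>w\<in>?L. neighbours G w))"
    using fin by (intro card_mono) auto
  also have "\<dots> \<le> card ({v} \<union> neighbours G v) + card (\<Union>w\<in>?L. neighbours G w)"
    by (rule card_Un_le)
  also have "card ({v} \<union> neighbours G v) \<le> 1 + t"
    using card_Un_le[of "{v}" "neighbours G v"] v(2) by simp
  also have "card (\<Union>w\<in>?L. neighbours G w) \<le> (\<Sum>w\<in>?L. card (neighbours G w))"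
    using fin by (intro card_UN_le) auto
  also have "\<dots> \<le> card ?L * t"
    using sum_bounded_above[of ?L "\<lambda>w. card (neighbours G w)" t] by simp
  also have "card ?L \<le> t"
    using v(2) card_mono[OF fin, of ?L v] by auto
  finally show False
    using large by simp
qed

section \<open>Counting edges\<close>

definition arcs :: "'a ugraph \<Rightarrow> 'a set \<Rightarrow> 'a set \<Rightarrow> ('a \<times> 'a) set" where
  "arcs G X Y = (SIGMA v:X. neighbours G v \<inter> Y)"

lemma finite_arcs: "is_graph G \<Longrightarrow> finite X \<Longrightarrow> finite (arcs G X Y)"
  by (simp add: arcs_def finite_neighbours)

lemma card_arcs:
  assumes "is_graph G" "finite X"
  shows "card (arcs G X Y) = (\<Sum>v\<in>X. card (neighbours G v \<inter> Y))"
  using assms by (simp add: arcs_def finite_neighbours)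

lemma card_arcs_sym: "card (arcs G X Y) = card (arcs G Y X)"
proof -
  have "arcs G Y X = prod.swap ` arcs G X Y"
    using neighbours_sym by (fastforce simp: arcs_def image_iff)
  then show ?thesis
    by (simp add: card_image)
qed

lemma card_arcs_le:
  assumes "is_graph G"
  shows "card (arcs G X Y) \<le> 2 * card (edges G)"
proof -
  have G: "finite (edges G)" "edges G \<subseteq> all_pairs (vertices G)"
    using assms finite_all_pairs finite_subset by (auto simp: is_graph_def)
  have arcs_of: "finite {(v, w). {v, w} = e} \<and> card {(v, w). {v, w} = e} \<le> 2"
    if e: "e \<in> edges G" for e
  proof -
    obtain a b where "e = {a, b}"
      using e G(2) by (blast elim: all_pairsE)
    then have eq: "{(v, w). {v, w} = e} = {(a, b), (b, a)}"
      by (auto simp: doubleton_eq_iff)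
    show ?thesis
      unfolding eq by (simp add: card_insert_le_m1)
  qed
  have "arcs G X Y \<subseteq> (\<Union>e\<in>edges G. {(v, w). {v, w} = e})"
    by (auto simp: arcs_def neighbours_def)
  then have "card (arcs G X Y) \<le> card (\<Union>e\<in>edges G. {(v, w). {v, w} = e})"
    using G(1) arcs_of by (intro card_mono) auto
  also have "\<dots> \<le> (\<Sum>e\<in>edges G. card {(v, w). {v, w} = e})"
    using G(1) by (rule card_UN_le)
  also have "\<dots> \<le> card (edges G) * 2"
    using sum_bounded_above[of "edges G" "\<lambda>e. card {(v, w). {v, w} = e}" 2] arcs_of by auto
  finally show ?thesis by simp
qed

text \<open>Give every edge weight two. An edge from the low-degree set \<open>B\<close> to its complement \<open>A\<close> hands its
  whole weight to its end in \<open>B\<close>, and an edge inside \<open>B\<close> hands one unit to each end. Then each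
  vertex of \<open>B\<close> receives at least \<open>2 (r - 2) + 1 = 2 r - 3\<close>: it has \<open>r - 2\<close> neighbours in \<open>A\<close>, and
  one further neighbour that contributes at least one unit wherever it lies. The inequality below
  combines \<open>(2 r - 3) |B| \<le> 2 e\<close> with the degree estimate \<open>(t + 1) |A| \<le> 2 e\<close>, with denominators
  cleared.\<close>

lemma cov_sat_edge_bound:
  assumes G: "is_graph G" "cov_sat (complete_graph r) G" and r: "r \<ge> 3"
    and large: "card (vertices G) > 1 + t + t * t"
  shows "card (vertices G) * (2 * r - 3) * (t + 1) \<le> 2 * card (edges G) * (t + 1 + (2 * r - 3))"
proof -
  define A where "A = {v \<in> vertices G. t < card (neighbours G v)}"
  define B where "B = vertices G - A"
  let ?N = "neighbours G" and ?e = "card (edges G)"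
  define k where "k = 2 * r - 3"
  have V: "finite (vertices G)"
    using G(1) by (simp add: is_graph_def)
  then have fin: "finite A" "finite B"
    by (auto simp: A_def B_def)
  have N_split: "?N v = (?N v \<inter> A) \<union> (?N v \<inter> B)" for v
    using neighbours_subset[OF G(1), of v] by (auto simp: B_def)
  have local_bound: "k \<le> 2 * card (?N v \<inter> A) + card (?N v \<inter> B)" if v: "v \<in> B" for v
  proof -
    have A_eq: "?N v \<inter> A = ?N v \<inter> {w. t < card (?N w)}"
      using neighbours_subset[OF G(1), of v] by (auto simp: A_def)
    have "v \<in> vertices G" "card (?N v) \<le> t" "semi_saturated (complete_graph r) G"
      using v G(2) by (auto simp: A_def B_def cov_sat_def)
    then have "r - 2 \<le> card (?N v \<inter> A)"
      unfolding A_eq using G(1) large by (intro low_degree_many_high_neighbours)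
    moreover have "r - 1 \<le> card (?N v)"
      using cov_sat_min_degree[OF G r] v by (simp add: B_def)
    moreover have "card (?N v) \<le> card (?N v \<inter> A) + card (?N v \<inter> B)"
      using N_split card_Un_le by metis
    ultimately show ?thesis
      unfolding k_def using r by linarith
  qed
  have "card B * k \<le> (\<Sum>v\<in>B. 2 * card (?N v \<inter> A) + card (?N v \<inter> B))"
    using sum_bounded_below[of B k "\<lambda>v. 2 * card (?N v \<inter> A) + card (?N v \<inter> B)"] local_bound
    by simp
  also have "\<dots> = 2 * card (arcs G B A) + card (arcs G B B)"
    using G(1) fin by (simp add: card_arcs sum.distrib sum_distrib_left)
  also have "\<dots> = card (arcs G B A) + card (arcs G A B) + card (arcs G B B)"
    using card_arcs_sym[of G A B] by simp
  also have "\<dots> = card (arcs G B A \<union> arcs G A B \<union> arcs G B B)"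
  proof -
    have "arcs G B A \<inter> arcs G A B = {}" "(arcs G B A \<union> arcs G A B) \<inter> arcs G B B = {}"
      by (auto simp: arcs_def B_def)
    then show ?thesis
      using finite_arcs[OF G(1)] fin by (simp add: card_Un_disjoint)
  qed
  also have "\<dots> \<le> card (arcs G (vertices G) (vertices G))"
    using finite_arcs[OF G(1) V] by (intro card_mono) (auto simp: arcs_def A_def B_def)
  also have "\<dots> \<le> 2 * ?e"
    by (rule card_arcs_le[OF G(1)])
  finally have B_bound: "card B * k \<le> 2 * ?e" .
  have "card A * (t + 1) \<le> (\<Sum>v\<in>A. card (?N v \<inter> UNIV))"
    using sum_bounded_below[of A "t + 1" "\<lambda>v. card (?N v)"] by (auto simp: A_def)
  also have "\<dots> = card (arcs G A UNIV)"
    by (rule card_arcs[symmetric, OF G(1) fin(1)])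
  also have "\<dots> \<le> 2 * ?e"
    by (rule card_arcs_le[OF G(1)])
  finally have A_bound: "card A * (t + 1) \<le> 2 * ?e" .
  have "card (vertices G) = card B + card A"
    using V by (simp add: B_def A_def card_Diff_subset card_mono)
  then have "card (vertices G) * k * (t + 1) = (card B * k) * (t + 1) + (card A * (t + 1)) * k"
    by (simp add: algebra_simps)
  also have "\<dots> \<le> 2 * ?e * (t + 1) + 2 * ?e * k"
    by (intro add_mono mult_right_mono A_bound B_bound) auto
  finally show ?thesis
    unfolding k_def[symmetric] by (simp add: algebra_simps)
qed

section \<open>The limit\<close>

lemma csat_upper:
  assumes "r \<ge> 2" "n \<ge> r"
  shows "csat n (complete_graph r) \<le> (r - 2) * n + (n + 1) div 2"
proof -
  obtain G :: "nat ugraph" where "is_graph G" "card (vertices G) = n"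
    "cov_sat (complete_graph r) G" and G: "card (edges G) \<le> (r - 2) * n + (n + 1) div 2"
    using small_cov_sat_graph[OF assms] by blast
  then have "csat n (complete_graph r) \<le> card (edges G)"
    unfolding csat_def by (intro Least_le) blast
  with G show ?thesis by linarith
qed

text \<open>For \<open>n \<ge> r\<close> the set of edge numbers in the definition of \<open>csat\<close> is nonempty by the construction
  above, so its least element is the edge number of an actual graph.\<close>

lemma csat_attained:
  assumes "r \<ge> 2" "n \<ge> r"
  obtains G :: "nat ugraph" where "is_graph G" "card (vertices G) = n"
    "cov_sat (complete_graph r) G" "card (edges G) = csat n (complete_graph r)"
proof -
  have "\<exists>m. \<exists>G :: nat ugraph. is_graph G \<and> card (vertices G) = n \<and>
      cov_sat (complete_graph r) G \<and> card (edges G) = m"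
    using small_cov_sat_graph[OF assms] by blast
  from LeastI_ex[OF this] that show ?thesis
    unfolding csat_def by blast
qed

lemma csat_ratio_lower:
  assumes r: "r \<ge> 3" and n: "n \<ge> r" "n > 1 + t + t * t"
  shows "(real r - 3 / 2) / (1 + (2 * real r - 3) / real (Suc t)) \<le>
    real (csat n (complete_graph r)) / real n"
proof -
  obtain G :: "nat ugraph" where G: "is_graph G" "card (vertices G) = n"
    "cov_sat (complete_graph r) G" "card (edges G) = csat n (complete_graph r)"
    using csat_attained[of r n] r n by auto
  have "n * (2 * r - 3) * (t + 1) \<le> 2 * csat n (complete_graph r) * (t + 1 + (2 * r - 3))"
    using cov_sat_edge_bound[OF G(1,3) r, of t] G(2,4) n by simp
  then have "real (n * (2 * r - 3) * (t + 1)) \<le>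
      real (2 * csat n (complete_graph r) * (t + 1 + (2 * r - 3)))"
    by (rule of_nat_mono)
  moreover have "real (2 * r - 3) = 2 * real r - 3"
    using r by (simp add: of_nat_diff)
  ultimately have main: "real n * (2 * real r - 3) * real (Suc t) \<le>
      2 * real (csat n (complete_graph r)) * (real (Suc t) + (2 * real r - 3))"
    by (simp only: of_nat_mult of_nat_add of_nat_1 of_nat_numeral Suc_eq_plus1)
  define s k c where "s = real (Suc t)" and "k = 2 * real r - 3"
    and "c = real (csat n (complete_graph r))"
  have pos: "s > 0" "k > 0" "real n > 0"
    using r n by (auto simp: s_def k_def)
  have "(real r - 3 / 2) / (1 + k / s) = (k * s) / (2 * (s + k))"
    using pos by (simp add: k_def field_simps)
  also have "\<dots> \<le> c / real n"
    using main pos unfolding s_def[symmetric] k_def[symmetric] c_def[symmetric]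
    by (simp add: divide_simps mult_ac add_pos_pos)
  finally show ?thesis
    by (simp add: s_def k_def c_def)
qed

lemma csat_ratio_upper:
  assumes "r \<ge> 3" "n \<ge> r"
  shows "real (csat n (complete_graph r)) / real n \<le> real r - 3 / 2 + 1 / real n"
proof -
  have "real (csat n (complete_graph r)) \<le> real ((r - 2) * n + (n + 1) div 2)"
    using csat_upper[of r n] assms by (intro of_nat_mono) auto
  also have "\<dots> \<le> (real r - 2) * real n + (real n + 1) / 2"
    using assms of_nat_div_le_of_nat[of "n + 1" 2, where ?'a = real] by (simp add: of_nat_diff)
  finally have "real (csat n (complete_graph r)) \<le> (real r - 3 / 2) * real n + 1"
    by (simp add: field_simps)
  moreover have "real n > 0"
    using assms by simp
  ultimately show ?thesis
    by (simp add: field_simps)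
qed

theorem theorem3p1:
  fixes r :: nat
  assumes "r \<ge> 3"
  shows "(\<lambda>n. real (csat n (complete_graph r)) / real n) \<longlonglongrightarrow> real r - 3 / 2"
proof (rule order_tendstoI)
  fix a assume a: "a < real r - 3 / 2"
  have "(\<lambda>t. (real r - 3 / 2) / (1 + (2 * real r - 3) / real (Suc t)))
      \<longlonglongrightarrow> (real r - 3 / 2) / (1 + 0)"
    by (intro tendsto_intros LIMSEQ_Suc lim_const_over_n) auto
  \<comment> \<open>The degree threshold is chosen before \<open>n\<close> and stays fixed while \<open>n\<close> tends to infinity.\<close>
  then have "\<forall>\<^sub>F t in sequentially. a < (real r - 3 / 2) / (1 + (2 * real r - 3) / real (Suc t))"
    using a by (intro order_tendstoD) auto
  then obtain t where t: "a < (real r - 3 / 2) / (1 + (2 * real r - 3) / real (Suc t))"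
    by (auto simp: eventually_sequentially)
  have "\<forall>\<^sub>F n in sequentially. n \<ge> r \<and> n > 1 + t + t * t"
    by (intro eventually_conj eventually_ge_at_top eventually_gt_at_top)
  then show "\<forall>\<^sub>F n in sequentially. a < real (csat n (complete_graph r)) / real n"
  proof eventually_elim
    case (elim n)
    then show ?case
      using csat_ratio_lower[of r n t] assms t by linarith
  qed
next
  fix a assume a: "real r - 3 / 2 < a"
  have "(\<lambda>n. real r - 3 / 2 + 1 / real n) \<longlonglongrightarrow> real r - 3 / 2 + 0"
    by (intro tendsto_intros lim_const_over_n)
  then have "\<forall>\<^sub>F n in sequentially. real r - 3 / 2 + 1 / real n < a"
    using a by (intro order_tendstoD) auto
  then show "\<forall>\<^sub>F n in sequentially. real (csat n (complete_graph r)) / real n < a"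
    using eventually_ge_at_top[of r]
  proof eventually_elim
    case (elim n)
    then show ?case
      using csat_ratio_upper[of r n] assms by linarith
  qed
qed

end
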